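(* Let $\alpha\in\mathbb{R}^p$ be $k$-tree-sparse in the tree $\mathcal{T}_{p,d}$ with support set $\mathcal{S}$, and suppose $k<p/d$. For any $c_1>0$ and $c_2\in(0,1)$, there exists a constant $c_3>0$ such that if $$\alpha_{\min}=\min_{i\in\mathcal{S}}|\alpha_i|\ \ge\ \sqrt{c_3\,\frac{\log k}{\beta^2}}$$ and $\tau=c_2\,\beta\,\alpha_{\min}$, then, when the adaptive tree sensing procedure (described in the context) with scaling parameter $\beta>0$ and threshold $\tau$ is applied to $x=D\alpha$, the following hold with probability at least $1-k^{-c_1}$: the total number of measurements obtained is $m=dk+1$, and the support estimate $\widehat{S}$, comprised of all the measured locations for which the corresponding measured value exceeds $\tau$ in amplitude, is equal to $\mathcal{S}$.
   Context: Trees: $\mathcal{T}_{p,d}$ denotes a balanced rooted connected tree of degree $d$ with $p$ nodes (the degree $d$ being the number of children of a node, as used in the procedure below). The components of $\alpha\in\mathbb{R}^p$ are in one-to-one correspondence with the nodes of $\mathcal{T}_{p,d}$, and index $1$ corresponds to the root. Tree sparsity: the support set of $\alpha$ is $\mathcal{S}=\{i:\alpha_i\neq 0\}$. The vector $\alpha$ is $k$-tree-sparse in $\mathcal{T}_{p,d}$ if it has $k$ nonzero components and these correspond to a rooted connected subtree of $\mathcal{T}_{p,d}$. Signal: $x=D\alpha\in\mathbb{R}^n$, where $D$ is a known $n\times p$ dictionary with orthonormal columns $d_1,\dots,d_p$. Adaptive tree sensing procedure with scaling $\beta>0$ and threshold $\tau>0$: initialize a data structure (a stack or a queue) with the index $1$.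 As long as the data structure is nonempty, obtain the next index $j$ from it and collect the measurement $y=\beta d_j^Tx+w$, where the noises $w$ of the successive measurements are i.i.d. $\mathcal{N}(0,1)$ (so that $y\sim\mathcal{N}(\beta\alpha_j,1)$). If the measurement is deemed significant, i.e. $|y|\ge\tau$, add the locations of the $d$ children of $j$ in $\mathcal{T}_{p,d}$ to the data structure; if not, add nothing. The procedure stops when the data structure is empty.
   Formalization: The count m = dk+1 is claimed only when every node of the support has exactly d children in the tree (k < p/d does not ensure this, as a support node may be a leaf); otherwise only m ≤ dk+1 is claimed, while Ŝ = S is claimed in all cases. *)

theory Defs
  imports
    "HOL-Probability.Probability"
    "HOL-Library.While_Combinator"
    "Jordan_Normal_Form.Matrix"
begin

hide_type (open) Finite_Cartesian_Product.vec
hide_const (open) Finite_Cartesian_Product.vec_nth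
no_notation Finite_Cartesian_Product.vec_nth (infixl \<open>$\<close> 90)
no_notation inner (infix \<open>\<bullet>\<close> 70)

section \<open>Trees\<close>

text \<open>A tree is its set of (parent, child) edges.  The nodes are the vector indices
  \<open>0, \<dots>, p - 1\<close>, following the 0-based indexing of vectors and matrices;
  the root is \<open>0\<close>.\<close>

definition rooted_tree :: "nat set \<Rightarrow> nat \<Rightarrow> nat rel \<Rightarrow> bool" where
  "rooted_tree V r T \<longleftrightarrow>
     r \<in> V \<and> T \<subseteq> V \<times> V \<and> (\<forall>u. (u, r) \<notin> T) \<and>
     (\<forall>v\<in>V - {r}. \<exists>!u. (u, v) \<in> T) \<and> (\<forall>v\<in>V. (r, v) \<in> T\<^sup>*)"

definition children :: "nat rel \<Rightarrow> nat \<Rightarrow> nat set" where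
  "children T v = T `` {v}"

definition level :: "nat rel \<Rightarrow> nat \<Rightarrow> nat \<Rightarrow> nat" where
  "level T r v = (LEAST l. (r, v) \<in> T ^^ l)"

definition height :: "nat set \<Rightarrow> nat \<Rightarrow> nat rel \<Rightarrow> nat" where
  "height V r T = Max (level T r ` V)"

text \<open>Every level except the deepest one is full.  For arbitrary \<open>p\<close> the nodes on the
  last but one level cannot all have exactly \<open>d\<close> children, so these may have fewer.\<close>

definition balanced_tree :: "nat \<Rightarrow> nat \<Rightarrow> nat rel \<Rightarrow> bool" where
  "balanced_tree p d T \<longleftrightarrow>
     rooted_tree {..<p} 0 T \<and>
     (\<forall>v<p. card (children T v) \<le> d) \<and>
     (\<forall>v<p. level T 0 v + 1 < height {..<p} 0 T \<longrightarrow> card (children T v) = d)"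

section \<open>Tree sparsity\<close>

definition support :: "real Matrix.vec \<Rightarrow> nat set" where
  "support \<alpha> = {i. i < dim_vec \<alpha> \<and> \<alpha> $ i \<noteq> 0}"

definition tree_sparse :: "nat \<Rightarrow> nat rel \<Rightarrow> real Matrix.vec \<Rightarrow> bool" where
  "tree_sparse k T \<alpha> \<longleftrightarrow>
     card (support \<alpha>) = k \<and> rooted_tree (support \<alpha>) 0 (Restr T (support \<alpha>))"

definition alpha_min :: "real Matrix.vec \<Rightarrow> real" where
  "alpha_min \<alpha> = Min ((\<lambda>i. \<bar>\<alpha> $ i\<bar>) ` support \<alpha>)"

definition orthonormal_cols :: "real mat \<Rightarrow> bool" where
  "orthonormal_cols D \<longleftrightarrow>
     (\<forall>i<dim_col D. \<forall>j<dim_col D. col D i \<bullet> col D j = (if i = j then 1 else 0))"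

section \<open>The adaptive tree sensing procedure\<close>

datatype discipline = Stack | Queue

fun insert_children :: "discipline \<Rightarrow> nat list \<Rightarrow> nat list \<Rightarrow> nat list" where
  "insert_children Stack cs js = cs @ js"
| "insert_children Queue cs js = js @ cs"

text \<open>The order in which the children of a node are added is arbitrary.\<close>

definition child_order :: "nat rel \<Rightarrow> (nat \<Rightarrow> nat list) \<Rightarrow> bool" where
  "child_order T ch \<longleftrightarrow> (\<forall>j. distinct (ch j) \<and> set (ch j) = children T j)"

record sensing_state =
  pending :: "nat list"
  measured :: "(nat \<times> real) list"

text \<open>The noise sequence \<open>w\<close> is indexed by time: \<open>w t\<close> is the noise of the measurement
  taken after \<open>t\<close> earlier ones, whichever location it is taken at.\<close>

definition sensing_step ::
  "discipline \<Rightarrow> (nat \<Rightarrow> nat list) \<Rightarrow> real mat \<Rightarrow> real Matrix.vec \<Rightarrow> real \<Rightarrow> real \<Rightarrow>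
   (nat \<Rightarrow> real) \<Rightarrow> sensing_state \<Rightarrow> sensing_state" where
  "sensing_step q ch D x \<beta> \<tau> w s =
     (case pending s of
        [] \<Rightarrow> s
      | j # js \<Rightarrow>
          (let y = \<beta> * (col D j \<bullet> x) + w (length (measured s))
           in \<lparr>pending = (if \<bar>y\<bar> \<ge> \<tau> then insert_children q (ch j) js else js),
               measured = measured s @ [(j, y)]\<rparr>))"

text \<open>The result is \<open>None\<close> if the procedure does not stop.\<close>

definition tree_sensing ::
  "discipline \<Rightarrow> (nat \<Rightarrow> nat list) \<Rightarrow> real mat \<Rightarrow> real Matrix.vec \<Rightarrow> real \<Rightarrow> real \<Rightarrow>
   (nat \<Rightarrow> real) \<Rightarrow> sensing_state option" where
  "tree_sensing q ch D x \<beta> \<tau> w =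
     while_option (\<lambda>s. pending s \<noteq> []) (sensing_step q ch D x \<beta> \<tau> w)
       \<lparr>pending = [0], measured = []\<rparr>"

text \<open>A significant node adds all the children it has in the tree.  Near the leaves these can be
  fewer than \<open>d\<close>, so a support of size \<open>k\<close> leads to \<open>d * k + 1\<close> measurements only if each of
  its nodes has \<open>d\<close> children, which \<open>k < p / d\<close> alone does not ensure.\<close>

definition num_measurements :: "sensing_state \<Rightarrow> nat" where
  "num_measurements s = length (measured s)"

definition support_estimate :: "real \<Rightarrow> sensing_state \<Rightarrow> nat set" where
  "support_estimate \<tau> s = {j. \<exists>y. (j, y) \<in> set (measured s) \<and> \<bar>y\<bar> > \<tau>}"

definition iid_std_normal :: "'a measure \<Rightarrow> (nat \<Rightarrow> 'a \<Rightarrow> real) \<Rightarrow> bool" where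
  "iid_std_normal M w \<longleftrightarrow>
     prob_space.indep_vars M (\<lambda>_. borel) w UNIV \<and>
     (\<forall>t. distributed M lborel (w t) std_normal_density)"

end

theory Submission
  imports Defs
begin

text \<open>The noise is indexed by time, so adaptivity plays no role in the probabilistic part: with
  \<open>\<delta> = min c2 (1 - c2) * \<beta> * alpha_min \<alpha>\<close>, on the event that the first \<open>d * k + 1\<close> noises are all
  smaller than \<open>\<delta>\<close> in absolute value every test made by the procedure has the right outcome, and the
  procedure measures exactly the root and the children of the support.  A union bound over
  the Gaussian tails \<open>2 * exp (- \<delta>\<^sup>2 / 2)\<close> bounds the probability of the complement.\<close>

section \<open>Deterministic analysis of the procedure\<close>

lemma set_insert_children [simp]: "set (insert_children q cs js) = set cs \<union> set js"
  by (cases q) auto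

lemma distinct_insert_children [simp]:
  "distinct (insert_children q cs js) \<longleftrightarrow> distinct cs \<and> distinct js \<and> set cs \<inter> set js = {}"
  by (cases q) auto

text \<open>\<open>R\<close> is exactly the set of locations that a run with only correct tests ever
  inserts. The time index stays below \<open>card R\<close> at every measurement, so correctness of
  the tests is demanded only for \<open>t < card R\<close>. Each test then keeps an invariant that
  determines the final state.\<close>

lemma tree_sensing_correct:
  fixes S :: "nat set" and T :: "nat rel" and w :: "nat \<Rightarrow> real"
  defines "R \<equiv> insert 0 (T `` S)"
  assumes root: "0 \<in> S" "\<And>u. (u, 0) \<notin> T"
    and parent_unique: "\<And>u u' v. (u, v) \<in> T \<Longrightarrow> (u', v) \<in> T \<Longrightarrow> u = u'"
    and reach: "\<And>v. v \<in> S \<Longrightarrow> (0, v) \<in> (Restr T S)\<^sup>*"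
    and fin: "finite R"
    and ch: "child_order T ch"
    and sig: "\<And>j t. j \<in> S \<Longrightarrow> t < card R \<Longrightarrow> \<tau> < \<bar>\<beta> * (col D j \<bullet> x) + w t\<bar>"
    and insig: "\<And>j t. j \<in> R - S \<Longrightarrow> t < card R \<Longrightarrow> \<bar>\<beta> * (col D j \<bullet> x) + w t\<bar> < \<tau>"
  shows "\<exists>s. tree_sensing q ch D x \<beta> \<tau> w = Some s \<and> num_measurements s = card R \<and>
    support_estimate \<tau> s = S"
proof -
  let ?locs = "\<lambda>s. set (map fst (measured s)) \<union> set (pending s)"
  \<comment> \<open>\<open>Closed\<close> and \<open>Parents\<close> are converse to each other.
    \<open>Closed\<close> ensures that nothing is missed: once no location is pending, the measured
    set contains all children of its support nodes. \<open>Parents\<close> ensures that nothing is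
    inserted twice: a location cannot appear before its parent has been measured.\<close>
  define Closed where "Closed s \<longleftrightarrow>
    (\<forall>u v. u \<in> set (map fst (measured s)) \<longrightarrow> u \<in> S \<longrightarrow> (u, v) \<in> T \<longrightarrow> v \<in> ?locs s)"
    for s :: sensing_state
  define Parents where "Parents s \<longleftrightarrow>
    (\<forall>v. v \<in> ?locs s \<longrightarrow> v \<noteq> 0 \<longrightarrow> (\<exists>u \<in> set (map fst (measured s)). (u, v) \<in> T))"
    for s :: sensing_state
  define Correct where "Correct s \<longleftrightarrow> (\<forall>j y. (j, y) \<in> set (measured s) \<longrightarrow>
      (j \<in> S \<longrightarrow> \<tau> < \<bar>y\<bar>) \<and> (j \<notin> S \<longrightarrow> \<bar>y\<bar> < \<tau>))" for s :: sensing_state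
  define P where "P s \<longleftrightarrow> distinct (map fst (measured s) @ pending s) \<and> ?locs s \<subseteq> R \<and>
    0 \<in> ?locs s \<and> Closed s \<and> Parents s \<and> Correct s" for s :: sensing_state
  let ?step = "sensing_step q ch D x \<beta> \<tau> w"
  let ?init = "\<lparr>pending = [0], measured = []\<rparr>"
  have dist: "distinct (map fst (measured s) @ pending s)" and sub: "?locs s \<subseteq> R"
    and zero: "0 \<in> ?locs s" if "P s" for s
    using that by (simp_all add: P_def)
  have closed: "v \<in> ?locs s"
    if "P s" "u \<in> set (map fst (measured s))" "u \<in> S" "(u, v) \<in> T" for s u v
    using that unfolding P_def Closed_def by (elim conjE) metis
  have par: "\<exists>u \<in> set (map fst (measured s)). (u, v) \<in> T"
    if "P s" "v \<in> ?locs s" "v \<noteq> 0" for s v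
    using that unfolding P_def Parents_def by (elim conjE) metis
  have vals: "(j \<in> S \<longrightarrow> \<tau> < \<bar>y\<bar>) \<and> (j \<notin> S \<longrightarrow> \<bar>y\<bar> < \<tau>)"
    if "P s" "(j, y) \<in> set (measured s)" for s j y
    using that unfolding P_def Correct_def by (elim conjE) metis
  have ch': "distinct (ch j)" "set (ch j) = {v. (j, v) \<in> T}" for j
    using ch by (auto simp: child_order_def children_def)
  \<comment> \<open>The measured and pending locations are distinct elements of \<open>R\<close>. A
    nonempty pending list makes the inequality strict, so the noise index of the next measurement
    lies in the range of \<open>sig\<close> and \<open>insig\<close>.\<close>
  have bound: "length (measured s) < card R" if "P s" "pending s \<noteq> []" for s
  proof -
    let ?L = "map fst (measured s) @ pending s"
    have "distinct ?L" "set ?L \<subseteq> R"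
      using dist sub that(1) by simp_all
    then have "length ?L \<le> card R"
      by (metis card_mono distinct_card fin)
    then show ?thesis using that(2) by (cases "pending s") auto
  qed
  have len: "length (measured (?step s)) = Suc (length (measured s))"
    if "pending s \<noteq> []" for s :: sensing_state
    using that by (auto simp: sensing_step_def Let_def split: list.split)
  have inv: "P (?step s)" if s: "P s" "pending s \<noteq> []" for s
  proof -
    obtain j js where js: "pending s = j # js" using s(2) by (cases "pending s") auto
    let ?ms = "map fst (measured s)"
    define y where "y = \<beta> * (col D j \<bullet> x) + w (length (measured s))"
    have t: "length (measured s) < card R" using bound s by blast
    note dist = dist[OF s(1), unfolded js]
    note sub = sub[OF s(1), unfolded js list.set]
    note zero = zero[OF s(1), unfolded js list.set]
    note closed = closed[OF s(1), unfolded js list.set]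
    note par = par[OF s(1), unfolded js list.set]
    note vals = vals[OF s(1)]
    have ms: "set (map fst (measured s @ [(j, y)])) = insert j (set ?ms)" by auto
    have mm: "set (measured s @ [(j, y)]) = insert (j, y) (set (measured s))" by auto
    have jR: "j \<in> R" using sub by auto
    show ?thesis
    proof (cases "j \<in> S")
      case True
      have yt: "\<bar>y\<bar> > \<tau>" using sig[OF True t] by (simp add: y_def)
      have step: "?step s = \<lparr>pending = insert_children q (ch j) js, measured = measured s @ [(j, y)]\<rparr>"
        using yt by (simp add: sensing_step_def js y_def[symmetric] Let_def)
      \<comment> \<open>By \<open>Parents\<close>, a child of \<open>j\<close> seen before would have \<open>j\<close> among the measured locations.\<close>
      have fresh: "v \<notin> set ?ms \<union> insert j (set js)" if "(j, v) \<in> T" for v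
      proof
        assume v: "v \<in> set ?ms \<union> insert j (set js)"
        moreover have "v \<noteq> 0" using that root(2)[of j] by metis
        ultimately obtain u where "u \<in> set ?ms" "(u, v) \<in> T" using par by blast
        then show False using parent_unique[OF that, of u] dist by auto
      qed
      have dist': "distinct (map fst (measured s @ [(j, y)]) @ insert_children q (ch j) js)"
        using dist fresh by (auto simp: ch')
      have sub': "set ?ms \<union> insert j (set js) \<union> {v. (j, v) \<in> T} \<subseteq> R"
        using sub True by (auto simp: R_def)
      have L: "insert j (set ?ms) \<union> set (insert_children q (ch j) js)
          = set ?ms \<union> insert j (set js) \<union> {v. (j, v) \<in> T}"
        by (auto simp: ch')
      have zero': "0 \<in> set ?ms \<union> insert j (set js) \<union> {v. (j, v) \<in> T}" using zero by blast
      have par': "\<forall>v. v \<in> set ?ms \<union> insert j (set js) \<union> {v. (j, v) \<in> T} \<longrightarrow> v \<noteq> 0 \<longrightarrow>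
          (\<exists>u \<in> insert j (set ?ms). (u, v) \<in> T)"
        using par by blast
      have closed': "\<forall>u v. u \<in> insert j (set ?ms) \<longrightarrow> u \<in> S \<longrightarrow> (u, v) \<in> T \<longrightarrow>
          v \<in> set ?ms \<union> insert j (set js) \<union> {v. (j, v) \<in> T}"
        using closed by blast
      have vals': "\<forall>i z. (i, z) \<in> insert (j, y) (set (measured s)) \<longrightarrow>
          (i \<in> S \<longrightarrow> \<tau> < \<bar>z\<bar>) \<and> (i \<notin> S \<longrightarrow> \<bar>z\<bar> < \<tau>)"
        using vals True yt by auto
      show ?thesis
        unfolding P_def Closed_def Parents_def Correct_def step sensing_state.simps ms mm L
        by (intro conjI dist' sub' zero' closed' par' vals')
    next
      case False
      have yt: "\<bar>y\<bar> < \<tau>" using insig[of j, OF _ t] False jR by (simp add: y_def)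
      have step: "?step s = \<lparr>pending = js, measured = measured s @ [(j, y)]\<rparr>"
        using yt by (simp add: sensing_step_def js y_def[symmetric] Let_def)
      have dist': "distinct (map fst (measured s @ [(j, y)]) @ js)"
        using dist by auto
      have L: "insert j (set ?ms) \<union> set js = set ?ms \<union> insert j (set js)"
        by auto
      have zero': "0 \<in> set ?ms \<union> insert j (set js)" using zero by blast
      have par': "\<forall>v. v \<in> set ?ms \<union> insert j (set js) \<longrightarrow> v \<noteq> 0 \<longrightarrow>
          (\<exists>u \<in> insert j (set ?ms). (u, v) \<in> T)"
        using par by blast
      have closed': "\<forall>u v. u \<in> insert j (set ?ms) \<longrightarrow> u \<in> S \<longrightarrow> (u, v) \<in> T \<longrightarrow>
          v \<in> set ?ms \<union> insert j (set js)"
        using closed False by blast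
      have vals': "\<forall>i z. (i, z) \<in> insert (j, y) (set (measured s)) \<longrightarrow>
          (i \<in> S \<longrightarrow> \<tau> < \<bar>z\<bar>) \<and> (i \<notin> S \<longrightarrow> \<bar>z\<bar> < \<tau>)"
        using vals False yt by auto
      show ?thesis
        unfolding P_def Closed_def Parents_def Correct_def step sensing_state.simps ms mm L
        by (intro conjI dist' sub zero' closed' par' vals')
    qed
  qed
  have init: "P ?init"
    by (auto simp: P_def Closed_def Parents_def Correct_def R_def)
  \<comment> \<open>Termination: each step measures one more location, and by \<open>bound\<close>
    the truncated difference is still positive before the step, hence strictly decreases.\<close>
  have "\<exists>s. while_option (\<lambda>s. pending s \<noteq> []) ?step ?init = Some s"
  proof (rule measure_while_option_Some[where P = P and f = "\<lambda>s. card R - length (measured s)"])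
    show "P (?step s) \<and> card R - length (measured (?step s)) < card R - length (measured s)"
      if "P s" "pending s \<noteq> []" for s
      using inv[OF that] len[OF that(2)] bound[OF that] by simp
  qed (fact init)
  then obtain s where s: "while_option (\<lambda>s. pending s \<noteq> []) ?step ?init = Some s" by blast
  have stopped: "pending s = []" using while_option_stop[OF s] by simp
  have Ps: "P s" using while_option_rule[of P, OF _ s] inv init by blast
  let ?ms = "map fst (measured s)"
  note dist = dist[OF Ps, unfolded stopped append_Nil2]
  note sub = sub[OF Ps, unfolded stopped list.set Un_empty_right]
  note zero = zero[OF Ps, unfolded stopped list.set Un_empty_right]
  note closed = closed[OF Ps, unfolded stopped list.set Un_empty_right]
  note vals = vals[OF Ps]
  \<comment> \<open>Follow the path from the root to \<open>v\<close> inside the support. With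
    nothing pending, \<open>closed\<close> passes from each node to the next.\<close>
  have S_ms: "v \<in> set ?ms" if "v \<in> S" for v
    using reach[OF that] by (induction rule: rtrancl_induct) (use zero closed in blast)+
  have ms_R: "set ?ms = R"
    using sub zero closed S_ms unfolding R_def by blast
  have "num_measurements s = card R"
    using distinct_card[OF dist] unfolding ms_R by (simp add: num_measurements_def)
  \<comment> \<open>The procedure tests with \<open>\<ge>\<close> and the estimate with
    \<open>>\<close>. The strict inequalities in \<open>Correct\<close> exclude amplitude
    \<open>\<tau>\<close>, so both criteria agree.\<close>
  moreover have "support_estimate \<tau> s = S"
  proof (intro Set.set_eqI iffI)
    fix j assume "j \<in> support_estimate \<tau> s"
    then show "j \<in> S" using vals by (fastforce simp: support_estimate_def split: if_splits)
  next
    fix j assume j: "j \<in> S"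
    then obtain y where "(j, y) \<in> set (measured s)" using S_ms by fastforce
    then show "j \<in> support_estimate \<tau> s" using vals j by (force simp: support_estimate_def)
  qed
  ultimately show ?thesis using s unfolding tree_sensing_def by blast
qed

section \<open>Measurability\<close>

text \<open>Since \<open>c\<close> fixes every state that violates \<open>b\<close>, iterating past
  the end changes nothing. Any stopped iterate will therefore do in place of the first one, which
  turns termination into a countable union over \<open>n\<close>.\<close>

lemma while_option_eq_iterate:
  assumes "\<And>s. \<not> b s \<Longrightarrow> c s = s"
  shows "while_option b c s = Some t \<longleftrightarrow> (\<exists>n. t = (c ^^ n) s \<and> \<not> b t)"
proof
  assume "\<exists>n. t = (c ^^ n) s \<and> \<not> b t"
  then obtain n where n: "t = (c ^^ n) s" "\<not> b t" by blast
  let ?k = "LEAST k. \<not> b ((c ^^ k) s)"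
  have k: "\<not> b ((c ^^ ?k) s)" using n by (metis (lifting) LeastI)
  have "?k \<le> n" using n by (auto intro: Least_le)
  have "(c ^^ (i + ?k)) s = (c ^^ ?k) s" for i
    by (induction i) (use k assms in auto)
  from this[of "n - ?k"] have "t = (c ^^ ?k) s" using n \<open>?k \<le> n\<close> by simp
  then show "while_option b c s = Some t"
    using n unfolding while_option_def by auto
qed (fact while_option_stop2)

text \<open>Replacing the measured values by the outcomes of their comparisons with the threshold leaves
  countably many states, and the event of interest depends on these only.\<close>

definition discrete_state :: "real \<Rightarrow> sensing_state \<Rightarrow> nat list \<times> (nat \<times> bool) list" where
  "discrete_state \<tau> s = (pending s, map (\<lambda>(j, y). (j, \<tau> < \<bar>y\<bar>)) (measured s))"

text \<open>One step acts on the discrete state alone, given the noise: the list of outcomes keeps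
  its length, hence the time index. For a fixed discrete state the next one depends measurably on
  \<open>\<omega>\<close>, and countably many such functions are glued together along the previous
  state.\<close>

lemma measurable_discrete_state:
  assumes [measurable]: "\<And>t. w t \<in> borel_measurable M"
  shows "(\<lambda>\<omega>. discrete_state \<tau> ((sensing_step q ch D x \<beta> \<tau> (\<lambda>t. w t \<omega>) ^^ n) s))
    \<in> measurable M (count_space UNIV)"
proof (induction n)
  case (Suc n)
  let ?s = "\<lambda>\<omega>. (sensing_step q ch D x \<beta> \<tau> (\<lambda>t. w t \<omega>) ^^ n) s"
  let ?y = "\<lambda>ms j \<omega>. \<beta> * (col D j \<bullet> x) + w (length ms) \<omega>"
  define f where "f a \<omega> = (case a of ([], ms) \<Rightarrow> ([], ms)
    | (j # js, ms) \<Rightarrow> (if \<tau> \<le> \<bar>?y ms j \<omega>\<bar> then insert_children q (ch j) js else js,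
        ms @ [(j, \<tau> < \<bar>?y ms j \<omega>\<bar>)]))" for a :: "nat list \<times> (nat \<times> bool) list" and \<omega>
  have "f a \<in> measurable M (count_space UNIV)" for a
  proof (cases a)
    case (Pair as ms)
    then show ?thesis
    proof (cases as)
      case (Cons j js)
      have "Measurable.pred M (\<lambda>\<omega>. \<tau> \<le> \<bar>?y ms j \<omega>\<bar>)" "Measurable.pred M (\<lambda>\<omega>. \<tau> < \<bar>?y ms j \<omega>\<bar>)"
        by measurable
      \<comment> \<open>For fixed \<open>a\<close> only two comparisons depend on
        \<open>\<omega>\<close>, so \<open>f a\<close> is a nested case distinction between
        constants.\<close>
      moreover have "f a = (\<lambda>\<omega>. if \<tau> \<le> \<bar>?y ms j \<omega>\<bar>
          then (if \<tau> < \<bar>?y ms j \<omega>\<bar> then (insert_children q (ch j) js, ms @ [(j, True)])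
            else (insert_children q (ch j) js, ms @ [(j, False)]))
          else (if \<tau> < \<bar>?y ms j \<omega>\<bar> then (js, ms @ [(j, True)]) else (js, ms @ [(j, False)])))"
        unfolding f_def Pair Cons by (auto simp: fun_eq_iff)
      ultimately show ?thesis
        by (simp add: measurable_If)
    next
      case Nil
      then have "f a = (\<lambda>_. ([], ms))" by (simp add: f_def Pair fun_eq_iff)
      then show ?thesis by simp
    qed
  qed
  then have "(\<lambda>\<omega>. f (discrete_state \<tau> (?s \<omega>)) \<omega>) \<in> measurable M (count_space UNIV)"
    using Suc by (rule measurable_compose_countable)
  moreover have "f (discrete_state \<tau> r) \<omega> =
      discrete_state \<tau> (sensing_step q ch D x \<beta> \<tau> (\<lambda>t. w t \<omega>) r)" for r \<omega>
    by (auto simp: f_def discrete_state_def sensing_step_def Let_def split: list.split)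
  ultimately show ?case by simp
qed simp

lemma sets_tree_sensing_event:
  assumes "\<And>t. w t \<in> borel_measurable M"
  shows "{\<omega> \<in> space M. \<exists>s. tree_sensing q ch D x \<beta> \<tau> (\<lambda>t. w t \<omega>) = Some s \<and>
    Q (num_measurements s) (support_estimate \<tau> s)} \<in> sets M"
proof -
  let ?s = "\<lambda>n \<omega>. (sensing_step q ch D x \<beta> \<tau> (\<lambda>t. w t \<omega>) ^^ n) \<lparr>pending = [0], measured = []\<rparr>"
  \<comment> \<open>\<open>G\<close> expresses the event after \<open>n\<close> steps, namely that
    the run has stopped and its results satisfy \<open>Q\<close>, through the discrete state
    alone.\<close>
  define G where "G = (\<lambda>(js :: nat list, ms). js = [] \<and> Q (length ms) {j :: nat. (j, True) \<in> set ms})"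
  have *: "G (discrete_state \<tau> s) \<longleftrightarrow>
      pending s = [] \<and> Q (num_measurements s) (support_estimate \<tau> s)" for s
  proof -
    have "{j. (j, True) \<in> (\<lambda>(j, y). (j, \<tau> < \<bar>y\<bar>)) ` set (measured s)} = support_estimate \<tau> s"
      by (force simp: support_estimate_def)
    then show ?thesis
      by (simp add: G_def discrete_state_def num_measurements_def)
  qed
  have "tree_sensing q ch D x \<beta> \<tau> v = Some s \<longleftrightarrow> (\<exists>n. s = (sensing_step q ch D x \<beta> \<tau> v ^^ n)
      \<lparr>pending = [0], measured = []\<rparr> \<and> pending s = [])" for v s
    unfolding tree_sensing_def by (subst while_option_eq_iterate) (auto simp: sensing_step_def)
  then have "(\<exists>s. tree_sensing q ch D x \<beta> \<tau> (\<lambda>t. w t \<omega>) = Some s \<and>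
      Q (num_measurements s) (support_estimate \<tau> s)) \<longleftrightarrow> (\<exists>n. G (discrete_state \<tau> (?s n \<omega>)))" for \<omega>
    using * by auto
  moreover have "{\<omega> \<in> space M. \<exists>n. G (discrete_state \<tau> (?s n \<omega>))} \<in> sets M"
  proof -
    have "Measurable.pred M (\<lambda>\<omega>. G (discrete_state \<tau> (?s n \<omega>)))" for n
      using measurable_discrete_state[OF assms] by (rule measurable_compose) simp
    then show ?thesis by measurable
  qed
  ultimately show ?thesis by simp
qed

section \<open>Gaussian tails\<close>

text \<open>Chernoff bound with the optimal parameter: the indicator of each one-sided tail is at
  most \<open>exp (a * X - a^2)\<close> with \<open>a = \<delta>\<close> or
  \<open>a = -\<delta>\<close>, whose expectation is \<open>exp (- \<delta>^2 / 2)\<close>. The two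
  sides give the factor 2.\<close>

lemma (in prob_space) std_normal_tail:
  assumes X: "distributed M lborel X std_normal_density" and "0 \<le> \<delta>"
  shows "\<P>(\<omega> in M. \<delta> \<le> \<bar>X \<omega>\<bar>) \<le> 2 * exp (- \<delta>\<^sup>2 / 2)"
proof -
  have [measurable]: "X \<in> borel_measurable M"
    using distributed_measurable[OF X] by simp
  \<comment> \<open>Completing the square: exponential tilting moves the mean to \<open>a\<close>,
    so the integral in \<open>mgf\<close> reduces to the total mass of a normal density.\<close>
  have shift: "std_normal_density x * exp (a * x - a\<^sup>2) = exp (- a\<^sup>2 / 2) * normal_density a 1 x" for a x
    by (simp add: normal_density_def mult_exp_exp exp_add[symmetric] power2_eq_square field_simps)
  have mgf: "(\<integral>\<^sup>+\<omega>. ennreal (exp (a * X \<omega> - a\<^sup>2)) \<partial>M) = ennreal (exp (- a\<^sup>2 / 2))" for a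
  proof -
    have "(\<integral>\<^sup>+\<omega>. ennreal (exp (a * X \<omega> - a\<^sup>2)) \<partial>M)
        = (\<integral>\<^sup>+x. ennreal (std_normal_density x) * ennreal (exp (a * x - a\<^sup>2)) \<partial>lborel)"
      by (rule distributed_nn_integral[OF X, symmetric]) simp
    also have "\<dots> = (\<integral>\<^sup>+x. ennreal (exp (- a\<^sup>2 / 2)) * ennreal (normal_density a 1 x) \<partial>lborel)"
      by (intro nn_integral_cong) (simp add: ennreal_mult'[symmetric] shift)
    also have "\<dots> = ennreal (exp (- a\<^sup>2 / 2)) * (\<integral>\<^sup>+x. ennreal (normal_density a 1 x) \<partial>lborel)"
      by (rule nn_integral_cmult) simp
    also have "(\<integral>\<^sup>+x. ennreal (normal_density a 1 x) \<partial>lborel) = 1"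
      by (subst nn_integral_eq_integral) auto
    finally show ?thesis by simp
  qed
  have A: "{\<omega> \<in> space M. \<delta> \<le> \<bar>X \<omega>\<bar>} \<in> sets M" by measurable
  \<comment> \<open>Depending on the sign of \<open>r\<close>, one of the two exponents is
    nonnegative, so that term alone is at least 1.\<close>
  have pt: "1 \<le> exp (\<delta> * r - \<delta>\<^sup>2) + exp (- \<delta> * r - (- \<delta>)\<^sup>2)" if "\<delta> \<le> \<bar>r\<bar>" for r
  proof -
    have "\<delta>\<^sup>2 \<le> \<delta> * \<bar>r\<bar>" using that assms(2) by (simp add: power2_eq_square mult_left_mono)
    then consider "0 \<le> \<delta> * r - \<delta>\<^sup>2" | "0 \<le> - \<delta> * r - (- \<delta>)\<^sup>2" by (cases "0 \<le> r") auto
    then show ?thesis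
    proof cases
      case 1
      then have "1 \<le> exp (\<delta> * r - \<delta>\<^sup>2)" by simp
      then show ?thesis by (smt (verit) exp_gt_zero)
    next
      case 2
      then have "1 \<le> exp (- \<delta> * r - (- \<delta>)\<^sup>2)" by simp
      then show ?thesis by (smt (verit) exp_gt_zero)
    qed
  qed
  have "emeasure M {\<omega> \<in> space M. \<delta> \<le> \<bar>X \<omega>\<bar>}
      = (\<integral>\<^sup>+\<omega>. indicator {\<omega> \<in> space M. \<delta> \<le> \<bar>X \<omega>\<bar>} \<omega> \<partial>M)"
    using A by simp
  also have "\<dots> \<le> (\<integral>\<^sup>+\<omega>. ennreal (exp (\<delta> * X \<omega> - \<delta>\<^sup>2)) + ennreal (exp (- \<delta> * X \<omega> - (- \<delta>)\<^sup>2)) \<partial>M)"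
  proof (intro nn_integral_mono)
    fix \<omega>
    show "indicator {\<omega> \<in> space M. \<delta> \<le> \<bar>X \<omega>\<bar>} \<omega>
        \<le> ennreal (exp (\<delta> * X \<omega> - \<delta>\<^sup>2)) + ennreal (exp (- \<delta> * X \<omega> - (- \<delta>)\<^sup>2))"
      using pt[of "X \<omega>"] by (auto simp: indicator_def ennreal_plus[symmetric] simp del: ennreal_plus)
  qed
  also have "\<dots> = ennreal (exp (- \<delta>\<^sup>2 / 2)) + ennreal (exp (- (- \<delta>)\<^sup>2 / 2))"
    by (subst nn_integral_add) (simp_all only: mgf, measurable)
  also have "\<dots> = ennreal (2 * exp (- \<delta>\<^sup>2 / 2))"
    by (simp add: ennreal_plus[symmetric] del: ennreal_plus)
  finally show ?thesis
    by (simp add: emeasure_eq_measure)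
qed

lemma (in prob_space) std_normal_max_tail:
  assumes X: "\<And>t. distributed M lborel (X t) std_normal_density" and "0 \<le> \<delta>"
  shows "1 - 2 * real N * exp (- \<delta>\<^sup>2 / 2) \<le> \<P>(\<omega> in M. \<forall>t<N. \<bar>X t \<omega>\<bar> < \<delta>)"
proof -
  have [measurable]: "X t \<in> borel_measurable M" for t
    using distributed_measurable[OF X] by simp
  let ?B = "\<lambda>t. {\<omega> \<in> space M. \<delta> \<le> \<bar>X t \<omega>\<bar>}"
  have "prob (\<Union>t<N. ?B t) \<le> (\<Sum>t<N. prob (?B t))"
    by (intro finite_measure_subadditive_finite) auto
  also have "\<dots> \<le> (\<Sum>t<N. 2 * exp (- \<delta>\<^sup>2 / 2))"
    by (intro sum_mono std_normal_tail X assms)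
  finally have "prob (\<Union>t<N. ?B t) \<le> 2 * real N * exp (- \<delta>\<^sup>2 / 2)" by simp
  moreover have "{\<omega> \<in> space M. \<forall>t<N. \<bar>X t \<omega>\<bar> < \<delta>} = space M - (\<Union>t<N. ?B t)"
    by (auto simp: not_le)
  moreover have "prob (space M - (\<Union>t<N. ?B t)) = 1 - prob (\<Union>t<N. ?B t)"
    by (rule prob_compl) auto
  ultimately show ?thesis by simp
qed

section \<open>Support recovery\<close>

lemma orthonormal_cols_scalar_prod:
  assumes D: "D \<in> carrier_mat n p" "orthonormal_cols D" and \<alpha>: "\<alpha> \<in> carrier_vec p" and "j < p"
  shows "col D j \<bullet> (D *\<^sub>v \<alpha>) = \<alpha> $ j"
proof -
  have "transpose_mat D * D = 1\<^sub>m p"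
    using D by (intro eq_matI) (auto simp: orthonormal_cols_def)
  moreover have "transpose_mat D *\<^sub>v (D *\<^sub>v \<alpha>) = (transpose_mat D * D) *\<^sub>v \<alpha>"
    using D \<alpha> by (intro assoc_mult_mat_vec[symmetric]) auto
  ultimately have "transpose_mat D *\<^sub>v (D *\<^sub>v \<alpha>) = \<alpha>" using \<alpha> by simp
  then have "(transpose_mat D *\<^sub>v (D *\<^sub>v \<alpha>)) $ j = \<alpha> $ j" by simp
  then show ?thesis using D \<open>j < p\<close> by simp
qed

text \<open>The threshold splits the smallest signal \<open>\<beta> * alpha_min \<alpha>\<close> in
  the ratio \<open>c2\<close> to \<open>1 - c2\<close>. Noise below the first part cannot lift a
  zero entry to \<open>\<tau>\<close>, and noise below the second cannot pull a support entry down
  to \<open>\<tau>\<close>. The number of measurements is the cardinality of the root together with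
  all children of the support.\<close>

lemma tree_sensing_support_recovery:
  fixes c2 \<beta> :: real and w :: "nat \<Rightarrow> real"
  assumes tree: "rooted_tree {..<p} 0 T" and deg: "\<And>v. v < p \<Longrightarrow> card (children T v) \<le> d"
    and \<alpha>: "\<alpha> \<in> carrier_vec p" and sparse: "tree_sparse k T \<alpha>"
    and D: "D \<in> carrier_mat n p" "orthonormal_cols D"
    and \<tau>: "\<tau> = c2 * \<beta> * alpha_min \<alpha>" and "0 < \<beta>" and ch: "child_order T ch"
    and noise: "\<And>t. t < d * k + 1 \<Longrightarrow> \<bar>w t\<bar> < min c2 (1 - c2) * \<beta> * alpha_min \<alpha>"
  shows "\<exists>s. tree_sensing q ch D (D *\<^sub>v \<alpha>) \<beta> \<tau> w = Some s \<and>
    num_measurements s \<le> d * k + 1 \<and>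
    ((\<forall>j\<in>support \<alpha>. card (children T j) = d) \<longrightarrow> num_measurements s = d * k + 1) \<and>
    support_estimate \<tau> s = support \<alpha>"
proof -
  let ?S = "support \<alpha>"
  let ?R = "insert 0 (T `` ?S)"
  have TV: "T \<subseteq> {..<p} \<times> {..<p}" and root: "(u, 0) \<notin> T" for u
    using tree by (simp_all add: rooted_tree_def)
  have uniq: "u = u'" if "(u, v) \<in> T" "(u', v) \<in> T" for u u' v
  proof -
    have "v \<noteq> 0" using that(1) root by metis
    then have v: "v \<in> {..<p} - {0}" using that(1) TV by auto
    have "\<forall>v\<in>{..<p} - {0}. \<exists>!u. (u, v) \<in> T"
      using tree unfolding rooted_tree_def by (elim conjE)
    from bspec[OF this v] show ?thesis using that by metis
  qed
  have S0: "0 \<in> ?S" and k: "card ?S = k" and reach: "\<forall>v \<in> ?S. (0, v) \<in> (Restr T ?S)\<^sup>*"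
    using sparse by (simp_all add: tree_sparse_def rooted_tree_def)
  have Sp: "?S \<subseteq> {..<p}" using \<alpha> by (auto simp: support_def)
  then have finS: "finite ?S" by (rule finite_subset) simp
  have Rp: "?R \<subseteq> {..<p}" using TV Sp S0 by auto
  then have finR: "finite ?R" by (rule finite_subset) simp
  have fin_ch: "finite (children T v)" for v
    using finite_subset[of "children T v" "{..<p}"] TV by (auto simp: children_def)
  have "0 \<notin> T `` ?S" using root by auto
  then have "card ?R = card (T `` ?S) + 1" using finR by simp
  moreover have "T `` ?S = (\<Union>v\<in>?S. children T v)" by (auto simp: children_def)
  \<comment> \<open>Uniqueness of parents makes the sets of children disjoint, so their sizes add
    up. The root is nobody's child and accounts for the additional 1.\<close>
  moreover have "card (\<Union>v\<in>?S. children T v) = (\<Sum>v\<in>?S. card (children T v))"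
  proof (intro card_UN_disjoint finS ballI fin_ch impI equals0I)
    fix u u' v assume "u \<noteq> u'" "v \<in> children T u \<inter> children T u'"
    then show False using uniq[of u v u'] by (simp add: children_def)
  qed
  ultimately have cardR: "card ?R = (\<Sum>v\<in>?S. card (children T v)) + 1" by simp
  have "(\<Sum>v\<in>?S. card (children T v)) \<le> (\<Sum>v\<in>?S. d)"
    using Sp deg by (intro sum_mono) auto
  then have le: "card ?R \<le> d * k + 1" by (simp add: cardR k mult.commute)
  have eq: "card ?R = d * k + 1" if "\<forall>j\<in>?S. card (children T j) = d"
    using that by (simp add: cardR k mult.commute)
  have meas: "\<beta> * (col D j \<bullet> (D *\<^sub>v \<alpha>)) = \<beta> * \<alpha> $ j" if "j < p" for j
    using orthonormal_cols_scalar_prod[OF D \<alpha> that] by simp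
  have nb: "\<bar>w t\<bar> < \<tau>" "\<bar>w t\<bar> < \<beta> * alpha_min \<alpha> - \<tau>" if "t < card ?R" for t
  proof -
    let ?m = "\<beta> * alpha_min \<alpha>"
    have w: "\<bar>w t\<bar> < min c2 (1 - c2) * ?m" using noise[of t] that le by (simp add: mult.assoc)
    have "0 \<le> alpha_min \<alpha>"
      unfolding alpha_min_def using finS S0 by (subst Min_ge_iff) auto
    then have "0 \<le> ?m" using \<open>0 < \<beta>\<close> by simp
    then have "min c2 (1 - c2) * ?m \<le> c2 * ?m" "min c2 (1 - c2) * ?m \<le> (1 - c2) * ?m"
      by (intro mult_right_mono; simp)+
    then show "\<bar>w t\<bar> < \<tau>" "\<bar>w t\<bar> < ?m - \<tau>" using w by (simp_all add: \<tau> algebra_simps)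
  qed
  have "\<exists>s. tree_sensing q ch D (D *\<^sub>v \<alpha>) \<beta> \<tau> w = Some s \<and>
      num_measurements s = card ?R \<and> support_estimate \<tau> s = ?S"
  proof (rule tree_sensing_correct[OF S0 root uniq bspec[OF reach] finR ch])
    fix j t assume j: "j \<in> ?S" and t: "t < card ?R"
    have "j < p" using j Sp by auto
    have "alpha_min \<alpha> \<le> \<bar>\<alpha> $ j\<bar>"
      unfolding alpha_min_def using finS j by (intro Min_le) auto
    then have "\<beta> * alpha_min \<alpha> \<le> \<bar>\<beta> * \<alpha> $ j\<bar>" using \<open>0 < \<beta>\<close> by (simp add: abs_mult)
    then show "\<tau> < \<bar>\<beta> * (col D j \<bullet> (D *\<^sub>v \<alpha>)) + w t\<bar>"
      unfolding meas[OF \<open>j < p\<close>] using nb[OF t] by linarith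
  next
    fix j t assume j: "j \<in> ?R - ?S" and t: "t < card ?R"
    then have j: "j < p" "\<alpha> $ j = 0" using Rp \<alpha> by (auto simp: support_def)
    show "\<bar>\<beta> * (col D j \<bullet> (D *\<^sub>v \<alpha>)) + w t\<bar> < \<tau>"
      unfolding meas[OF j(1)] using nb[OF t] j(2) by simp
  qed
  then show ?thesis using le eq by auto
qed

text \<open>As \<open>k\<close> is at least 2, constants can be absorbed into powers of
  \<open>k\<close>: the factor \<open>2 * (d * k + 1)\<close> is at most
  \<open>k ^ (2 * d + 3)\<close>. The summand \<open>2 * real d + 3\<close> in the hypothesis pays
  for this factor, and \<open>c1\<close> remains as the exponent.\<close>

lemma union_bound_le:
  fixes k d :: nat and c1 \<delta> :: real
  assumes "2 \<le> k" and \<delta>: "2 * ((c1 + 2 * real d + 3) * ln (real k)) \<le> \<delta>\<^sup>2"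
  shows "2 * real (d * k + 1) * exp (- \<delta>\<^sup>2 / 2) \<le> real k powr (- c1)"
proof -
  have "2 * (d * k + 1) \<le> 2 * (d + 1) * k" using assms(1) by simp
  then have "2 * real (d * k + 1) \<le> real (2 * (d + 1)) * real k"
    by (metis of_nat_le_iff of_nat_mult of_nat_numeral)
  \<comment> \<open>The bound \<open>m < 2 ^ m\<close> turns the constant into a power of 2, which
    is then at most the same power of \<open>k\<close>.\<close>
  also have "real (2 * (d + 1)) \<le> real (2 ^ (2 * (d + 1)))"
    by (metis less_exp less_imp_le of_nat_le_iff)
  also have "\<dots> \<le> real k ^ (2 * (d + 1))"
    using power_mono[of 2 "real k" "2 * (d + 1)"] assms(1) by simp
  finally have "2 * real (d * k + 1) \<le> real k ^ (2 * (d + 1)) * real k" by (simp add: mult_right_mono)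
  also have "\<dots> = real k ^ (2 * d + 3)" by (simp add: power_add eval_nat_numeral)
  also have "\<dots> = real k powr (2 * real d + 3)"
    using assms(1) powr_realpow[of "real k" "2 * d + 3"] by simp
  finally have 1: "2 * real (d * k + 1) \<le> real k powr (2 * real d + 3)" .
  have "exp (- \<delta>\<^sup>2 / 2) \<le> exp (- (c1 + 2 * real d + 3) * ln (real k))"
    using \<delta> by (simp add: algebra_simps)
  also have "\<dots> = real k powr (- (c1 + 2 * real d + 3))"
    using assms(1) by (simp add: powr_def)
  finally have "2 * real (d * k + 1) * exp (- \<delta>\<^sup>2 / 2)
      \<le> real k powr (2 * real d + 3) * real k powr (- (c1 + 2 * real d + 3))"
    using 1 by (intro mult_mono) auto
  also have "\<dots> = real k powr (- c1)"
    by (simp add: powr_add[symmetric])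
  finally show ?thesis .
qed

theorem theorem1:
  fixes d :: nat and c1 c2 :: real
  assumes "d \<ge> 1" and "c1 > 0" and "0 < c2" and "c2 < 1"
  shows "\<exists>c3>0. \<forall>(p::nat) (k::nat) (n::nat) (T::nat rel) (\<alpha>::real Matrix.vec) (D::real mat)
      (\<beta>::real) (\<tau>::real) (q::discipline) (ch::nat \<Rightarrow> nat list)
      (M::'a measure) (w::nat \<Rightarrow> 'a \<Rightarrow> real).
    balanced_tree p d T \<longrightarrow>
    \<alpha> \<in> carrier_vec p \<longrightarrow>
    tree_sparse k T \<alpha> \<longrightarrow>
    real k < real p / real d \<longrightarrow>
    D \<in> carrier_mat n p \<longrightarrow>
    orthonormal_cols D \<longrightarrow>
    \<beta> > 0 \<longrightarrow>
    alpha_min \<alpha> \<ge> sqrt (c3 * (ln (real k) / \<beta>\<^sup>2)) \<longrightarrow>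
    \<tau> = c2 * \<beta> * alpha_min \<alpha> \<longrightarrow>
    child_order T ch \<longrightarrow>
    prob_space M \<longrightarrow>
    iid_std_normal M w \<longrightarrow>
    \<P>(\<omega> in M. \<exists>s. tree_sensing q ch D (D *\<^sub>v \<alpha>) \<beta> \<tau> (\<lambda>t. w t \<omega>) = Some s \<and>
        num_measurements s \<le> d * k + 1 \<and>
        ((\<forall>j\<in>support \<alpha>. card (children T j) = d) \<longrightarrow> num_measurements s = d * k + 1) \<and>
        support_estimate \<tau> s = support \<alpha>)
      \<ge> 1 - real k powr (- c1)"
proof -
  define c where "c = min c2 (1 - c2)"
  \<comment> \<open>The factor \<open>2 / c^2\<close> cancels the \<open>c^2\<close> in the squared
    noise margin and the halving in the Gaussian exponent. The rest is the coefficient required by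
    \<open>union_bound_le\<close>.\<close>
  define c3 where "c3 = 2 / c\<^sup>2 * (c1 + 2 * real d + 3)"
  have c: "0 < c" using assms by (simp add: c_def)
  have c3: "0 < c3" using c assms by (simp add: c3_def)
  show ?thesis
  proof (intro exI[of _ c3] conjI c3 allI impI)
    fix p k n T and \<alpha> :: "real Matrix.vec" and D \<beta> \<tau> q ch and M :: "'a measure" and w
    assume tree: "balanced_tree p d T" and \<alpha>: "\<alpha> \<in> carrier_vec p" and sparse: "tree_sparse k T \<alpha>"
      and D: "D \<in> carrier_mat n p" "orthonormal_cols D" and \<beta>: "\<beta> > 0"
      and amin: "alpha_min \<alpha> \<ge> sqrt (c3 * (ln (real k) / \<beta>\<^sup>2))"
      and \<tau>: "\<tau> = c2 * \<beta> * alpha_min \<alpha>" and ch: "child_order T ch"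
      and M: "prob_space M" and iid: "iid_std_normal M w"
    interpret prob_space M by fact
    let ?E = "{\<omega> \<in> space M. \<exists>s. tree_sensing q ch D (D *\<^sub>v \<alpha>) \<beta> \<tau> (\<lambda>t. w t \<omega>) = Some s \<and>
        num_measurements s \<le> d * k + 1 \<and>
        ((\<forall>j\<in>support \<alpha>. card (children T j) = d) \<longrightarrow> num_measurements s = d * k + 1) \<and>
        support_estimate \<tau> s = support \<alpha>}"
    have dist: "distributed M lborel (w t) std_normal_density" for t
      using iid by (simp add: iid_std_normal_def)
    have meas: "w t \<in> borel_measurable M" for t
      using distributed_measurable[OF dist] by simp
    \<comment> \<open>The lower bound is transferred from a smaller event by monotonicity of the
      measure, which requires the larger event to be measurable.\<close>
    have E: "?E \<in> sets M"
      by (rule sets_tree_sensing_event[OF meas])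
    show "1 - real k powr (- c1) \<le> prob ?E"
    proof (cases "k \<le> 1")
      \<comment> \<open>The root belongs to the support, so \<open>k = 1\<close>. Then
        \<open>ln k = 0\<close> and \<open>alpha_min\<close> need not be large, but the claimed
        lower bound on the probability is 0.\<close>
      case True
      have "0 \<in> support \<alpha>" using sparse by (simp add: tree_sparse_def rooted_tree_def)
      moreover have "finite (support \<alpha>)" by (simp add: support_def)
      ultimately have "card (support \<alpha>) \<noteq> 0" by auto
      then have "k = 1" using True sparse by (simp add: tree_sparse_def)
      then show ?thesis by simp
    next
      case False
      \<comment> \<open>The noise margin of \<open>tree_sensing_support_recovery\<close>. The
        assumption on \<open>alpha_min\<close> bounds its square from below by a multiple of
        \<open>ln k\<close>.\<close>
      define \<delta> where "\<delta> = c * \<beta> * alpha_min \<alpha>"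
      have L: "0 \<le> c3 * (ln (real k) / \<beta>\<^sup>2)" using False c3 by simp
      have a0: "0 \<le> alpha_min \<alpha>" using amin L by (meson order_trans real_sqrt_ge_zero)
      have "c3 * (ln (real k) / \<beta>\<^sup>2) \<le> (alpha_min \<alpha>)\<^sup>2"
        using amin a0 by (simp add: sqrt_le_D)
      then have "c3 * ln (real k) \<le> \<beta>\<^sup>2 * (alpha_min \<alpha>)\<^sup>2"
        using \<beta> by (simp add: pos_divide_le_eq mult.commute)
      then have "c\<^sup>2 * (c3 * ln (real k)) \<le> c\<^sup>2 * (\<beta>\<^sup>2 * (alpha_min \<alpha>)\<^sup>2)"
        by (rule mult_left_mono) simp
      also have "\<dots> = \<delta>\<^sup>2" by (simp add: \<delta>_def power_mult_distrib)
      also have "c\<^sup>2 * (c3 * ln (real k)) = 2 * ((c1 + 2 * real d + 3) * ln (real k))"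
        using c by (simp add: c3_def)
      finally have "2 * real (d * k + 1) * exp (- \<delta>\<^sup>2 / 2) \<le> real k powr (- c1)"
        using False by (intro union_bound_le) auto
      moreover have "1 - 2 * real (d * k + 1) * exp (- \<delta>\<^sup>2 / 2)
          \<le> prob {\<omega> \<in> space M. \<forall>t<d * k + 1. \<bar>w t \<omega>\<bar> < \<delta>}"
        using c \<beta> a0 by (intro std_normal_max_tail dist) (simp add: \<delta>_def)
      moreover have "prob {\<omega> \<in> space M. \<forall>t<d * k + 1. \<bar>w t \<omega>\<bar> < \<delta>} \<le> prob ?E"
      proof (rule finite_measure_mono[OF _ E], rule Collect_mono, rule impI, elim conjE, rule conjI)
        fix \<omega> assume w: "\<forall>t<d * k + 1. \<bar>w t \<omega>\<bar> < \<delta>"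
        show "\<exists>s. tree_sensing q ch D (D *\<^sub>v \<alpha>) \<beta> \<tau> (\<lambda>t. w t \<omega>) = Some s \<and>
            num_measurements s \<le> d * k + 1 \<and>
            ((\<forall>j\<in>support \<alpha>. card (children T j) = d) \<longrightarrow> num_measurements s = d * k + 1) \<and>
            support_estimate \<tau> s = support \<alpha>"
          using tree w
          by (intro tree_sensing_support_recovery[OF _ _ \<alpha> sparse D \<tau> \<beta> ch])
            (auto simp: balanced_tree_def \<delta>_def c_def)
      qed
      ultimately show ?thesis by linarith
    qed
  qed
qed

end
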